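(* Let $d \ge 2$ and $a$ be integers with $0 < a < d$ and $\gcd(a,d) = 1$, and let $k_i, q_i, \theta'_i$ be the quantities obtained from the extended Euclidean algorithm on $a$ and $d$, as described in the context. Let $b$ be an integer with $0 \le b \le d-1$, and suppose that $b$ is written in the $(\theta'_i)_{i<n}$ number scale as $$ b = \sum_{i=1}^{n+1} b_i \theta'_{i-1}, $$ with $b_{n+1} = 0$ and $b_1, \dots, b_n$ nonnegative integers satisfying the conditions $0 \le b_1 \le k_1 - 1$, $0 \le b_i \le k_i$ for $2 \le i \le n$, and $b_{i+1} = 0$ whenever $b_i = k_i$ (for $1 \le i \le n-1$). Let $$ c = \sum_{i=1}^{n+1} b_i (-1)^{i-1} q_{i-1}. $$ Then $a^{-1}\cdot b \bmod d \in \{c,\; d + c\}$, where $a^{-1}\cdot b \bmod d$ denotes the unique integer $x$ with $0 \le x < d$ and $a x \equiv b \pmod d$.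
   Context: Euclidean algorithm data: set $\theta'_{-1} = d$, $\theta'_0 = a$, and for $i \ge 1$, while $\theta'_{i-1} \neq 0$, put $k_i = \lfloor \theta'_{i-2}/\theta'_{i-1} \rfloor$ and $\theta'_i = \theta'_{i-2} - k_i \theta'_{i-1}$; let $n$ be the index with $\theta'_n = 0$ (so $a/d = [0; k_1, \dots, k_n]$). Define $p_{-1} = 1$, $p_0 = 0$, $q_{-1} = 0$, $q_0 = 1$, and $p_i = p_{i-2} + k_i p_{i-1}$, $q_i = q_{i-2} + k_i q_{i-1}$ for $1 \le i \le n$. One has $\theta'_i = (-1)^i (q_i a - p_i d)$. *)

theory Defs
  imports "HOL-Number_Theory.Number_Theory"
begin

text \<open>The recursions for the remainders and the convergent denominators start at index \<open>-1\<close>, so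
  they are stored with an offset of one: \<open>euclid_rem a d j\<close> is $\theta'_{j-1}$ and
  \<open>euclid_den a d j\<close> is $q_{j-1}$. The definitions \<open>euclid_theta\<close>, \<open>euclid_k\<close> and \<open>euclid_q\<close> below
  undo the offset. Integer division \<open>div\<close> is the floor of the quotient. Beyond
  the first index where the remainder is zero the values carry no meaning.\<close>

fun euclid_rem :: "int \<Rightarrow> int \<Rightarrow> nat \<Rightarrow> int" where
  "euclid_rem a d 0 = d"
| "euclid_rem a d (Suc 0) = a"
| "euclid_rem a d (Suc (Suc j)) =
     euclid_rem a d j - (euclid_rem a d j div euclid_rem a d (Suc j)) * euclid_rem a d (Suc j)"

definition euclid_theta :: "int \<Rightarrow> int \<Rightarrow> nat \<Rightarrow> int" where
  "euclid_theta a d i = euclid_rem a d (Suc i)"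

text \<open>$k_i = \lfloor \theta'_{i-2} / \theta'_{i-1} \rfloor$; only meaningful for $i \ge 1$.\<close>

definition euclid_k :: "int \<Rightarrow> int \<Rightarrow> nat \<Rightarrow> int" where
  "euclid_k a d i = euclid_rem a d (i - 1) div euclid_rem a d i"

fun euclid_den :: "int \<Rightarrow> int \<Rightarrow> nat \<Rightarrow> int" where
  "euclid_den a d 0 = 0"
| "euclid_den a d (Suc 0) = 1"
| "euclid_den a d (Suc (Suc j)) =
     euclid_den a d j + euclid_k a d (Suc j) * euclid_den a d (Suc j)"

definition euclid_q :: "int \<Rightarrow> int \<Rightarrow> nat \<Rightarrow> int" where
  "euclid_q a d i = euclid_den a d (Suc i)"

definition euclid_length :: "int \<Rightarrow> int \<Rightarrow> nat" where
  "euclid_length a d = (LEAST n. euclid_theta a d n = 0)"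

definition mod_quotient :: "int \<Rightarrow> int \<Rightarrow> int \<Rightarrow> int" where
  "mod_quotient d a b = (THE x. 0 \<le> x \<and> x < d \<and> [a * x = b] (mod d))"

lemma euclid_theta_0: "euclid_theta a d 0 = a"
  and euclid_theta_1: "euclid_theta a d 1 = d - euclid_k a d 1 * a"
  and euclid_theta_rec: "euclid_theta a d (i + 2) =
        euclid_theta a d i - euclid_k a d (i + 2) * euclid_theta a d (i + 1)"
  by (simp_all add: euclid_theta_def euclid_k_def)

lemma euclid_k_1: "euclid_k a d 1 = \<lfloor>of_int d / (of_int a :: real)\<rfloor>"
  and euclid_k_rec: "euclid_k a d (i + 2) =
        \<lfloor>of_int (euclid_theta a d i) / (of_int (euclid_theta a d (i + 1)) :: real)\<rfloor>"
  unfolding floor_divide_of_int_eq by (simp_all add: euclid_theta_def euclid_k_def)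

lemma euclid_q_0: "euclid_q a d 0 = 1"
  and euclid_q_1: "euclid_q a d 1 = euclid_k a d 1"
  and euclid_q_rec: "euclid_q a d (i + 2) =
        euclid_q a d i + euclid_k a d (i + 2) * euclid_q a d (i + 1)"
  by (simp_all add: euclid_q_def)

lemma euclid_theta_eventually_0:
  assumes "0 < a"
  shows "\<exists>n. euclid_theta a d n = 0"
proof (rule ccontr)
  assume nz: "\<not> (\<exists>n. euclid_theta a d n = 0)"
  have step: "euclid_rem a d (Suc (Suc j)) = euclid_rem a d j mod euclid_rem a d (Suc j)" for j
    by (simp add: minus_div_mult_eq_mod)
  have pos: "0 < euclid_theta a d m" for m
  proof (induction m)
    case 0
    show ?case using assms by (simp add: euclid_theta_def)
  next
    case (Suc m)
    then have "0 \<le> euclid_theta a d (Suc m)"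
      by (simp only: euclid_theta_def step pos_mod_sign)
    moreover have "euclid_theta a d (Suc m) \<noteq> 0" using nz by blast
    ultimately show ?case by linarith
  qed
  have dec: "euclid_theta a d (Suc m) < euclid_theta a d m" for m
    using pos[of m] by (simp only: euclid_theta_def step pos_mod_bound)
  have "euclid_theta a d m \<le> a - int m" for m
  proof (induction m)
    case 0
    show ?case by (simp add: euclid_theta_def)
  next
    case (Suc m)
    then show ?case using dec[of m] by simp
  qed
  from this[of "nat a"] pos[of "nat a"] assms show False by simp
qed

lemma mod_quotient_ex1:
  fixes a b d :: int
  assumes "0 < d" and "coprime a d"
  shows "\<exists>!x. 0 \<le> x \<and> x < d \<and> [a * x = b] (mod d)"
proof -
  obtain y where y: "[a * y = 1] (mod d)"
    using assms(2) cong_solve_coprime_int by blast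
  have "[a * (y * b mod d) = a * (y * b)] (mod d)"
    by (simp add: cong_def mod_mult_right_eq)
  also have "[a * (y * b) = 1 * b] (mod d)"
    using cong_mult[OF y cong_refl[of b]] by (simp add: mult.assoc)
  finally have ex: "[a * (y * b mod d) = b] (mod d)" by simp
  show ?thesis
  proof (rule ex1I)
    show "0 \<le> y * b mod d \<and> y * b mod d < d \<and> [a * (y * b mod d) = b] (mod d)"
      using ex assms(1) by simp
  next
    fix x assume x: "0 \<le> x \<and> x < d \<and> [a * x = b] (mod d)"
    then have "[a * x = a * (y * b mod d)] (mod d)"
      using ex cong_sym cong_trans by blast
    then have "[x = y * b mod d] (mod d)"
      using assms(2) by (simp only: cong_mult_lcancel)
    with x assms(1) show "x = y * b mod d"
      by (simp add: cong_def)
  qed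
qed

end

theory Submission
  imports Defs
begin

text \<open>Since $\theta'_i \equiv (-1)^i q_i a \pmod d$, multiplying $c$ by $a$ gives $b$ modulo $d$, so
  only $\vert c \vert < d$ has to be shown. If $S_m$ is the sum of the first $m$ terms of $c$, then
  $T_m = (-1)^{m-1} S_m$ satisfies $T_{m+1} = b_{m+1} q_m - T_m$, and $q_{m+1} = q_{m-1} + k_{m+1} q_m$
  yields $1 - q_{m-1} \le T_m \le q_m - 1$ by induction. The invariant
  $q_i \theta'_{i-1} + q_{i-1} \theta'_i = d$ bounds the denominators by $d$.\<close>

lemma euclid_rem_eq_mod:
  "euclid_rem a d (Suc (Suc j)) = euclid_rem a d j mod euclid_rem a d (Suc j)"
  by (simp add: minus_div_mult_eq_mod)

lemma euclid_rem_pos: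
  assumes "0 < a" "0 < d" "j \<le> euclid_length a d"
  shows "0 < euclid_rem a d j"
  using assms(3)
proof (induction j rule: induct_nat_012)
  case (ge2 j)
  have "euclid_rem a d (Suc (Suc j)) \<noteq> 0"
    using ge2(3) not_less_Least[of "Suc j" "\<lambda>n. euclid_theta a d n = 0"]
    by (simp add: euclid_length_def euclid_theta_def del: euclid_rem.simps)
  moreover have "0 \<le> euclid_rem a d (Suc (Suc j))"
    unfolding euclid_rem_eq_mod using ge2 by (intro pos_mod_sign) simp
  ultimately show ?case by linarith
qed (use assms in auto)

lemma euclid_den_nonneg:
  assumes "0 < a" "0 < d" "j \<le> Suc (euclid_length a d)"
  shows "0 \<le> euclid_den a d j"
  using assms(3)
proof (induction j rule: induct_nat_012)
  case (ge2 j)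
  have "0 \<le> euclid_k a d (Suc j)"
    using euclid_rem_pos[OF assms(1,2), of j] euclid_rem_pos[OF assms(1,2), of "Suc j"] ge2(3)
    by (simp add: euclid_k_def pos_imp_zdiv_nonneg_iff)
  with ge2 show ?case by simp
qed auto

text \<open>Passing from j to j + 1, the two terms containing the partial quotient occur with
  opposite signs and cancel.\<close>

lemma euclid_den_rem_invariant:
  "euclid_den a d (Suc j) * euclid_rem a d j + euclid_den a d j * euclid_rem a d (Suc j) = d"
  by (induction j) (simp_all add: euclid_k_def algebra_simps)

lemma euclid_den_le:
  assumes "0 < a" "0 < d" "j \<le> euclid_length a d"
  shows "euclid_den a d (Suc j) \<le> d"
proof -
  have pos: "0 < euclid_rem a d j" using euclid_rem_pos assms by blast
  have den: "0 \<le> euclid_den a d j" "0 \<le> euclid_den a d (Suc j)"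
    using euclid_den_nonneg[OF assms(1,2)] assms(3) by simp_all
  \<comment> \<open>For \<open>j = euclid_length a d\<close> this remainder is zero, outside the
    range of \<open>euclid_rem_pos\<close>; as a residue modulo a positive number it is still
    nonnegative.\<close>
  have "0 \<le> euclid_rem a d (Suc j)"
  proof (cases j)
    case (Suc i)
    then show ?thesis
      using pos unfolding Suc euclid_rem_eq_mod by (intro pos_mod_sign)
  qed (use assms in simp)
  with den have "euclid_den a d (Suc j) * euclid_rem a d j \<le> d"
    using euclid_den_rem_invariant[of a d j] mult_nonneg_nonneg[of "euclid_den a d j" "euclid_rem a d (Suc j)"]
    by linarith
  moreover have "euclid_den a d (Suc j) * 1 \<le> euclid_den a d (Suc j) * euclid_rem a d j"
    using den pos by (intro mult_left_mono) auto
  ultimately show ?thesis by simp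
qed

lemma dvd_euclid_rem_den:
  "d dvd euclid_rem a d j + (-1) ^ j * euclid_den a d j * a"
proof (induction j rule: induct_nat_012)
  case (ge2 j)
  have "euclid_rem a d (Suc (Suc j)) + (-1) ^ Suc (Suc j) * euclid_den a d (Suc (Suc j)) * a
      = (euclid_rem a d j + (-1) ^ j * euclid_den a d j * a)
        - euclid_k a d (Suc j)
          * (euclid_rem a d (Suc j) + (-1) ^ Suc j * euclid_den a d (Suc j) * a)"
    by (simp add: euclid_k_def algebra_simps)
  with ge2 show ?case by (metis dvd_diff dvd_mult)
qed auto

lemma cong_euclid_theta: "[a * ((-1) ^ i * euclid_q a d i) = euclid_theta a d i] (mod d)"
  using dvd_euclid_rem_den[of d a "Suc i"]
  by (simp add: cong_iff_dvd_diff euclid_theta_def euclid_q_def dvd_diff_commute algebra_simps)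

lemma alternating_digit_sum_bounds:
  fixes bs :: "nat \<Rightarrow> int"
  assumes "0 < a" "0 < d" "m < euclid_length a d"
    and "0 \<le> bs 1" "bs 1 \<le> euclid_k a d 1 - 1"
    and digits: "\<And>i. 2 \<le> i \<Longrightarrow> i \<le> euclid_length a d \<Longrightarrow> 0 \<le> bs i \<and> bs i \<le> euclid_k a d i"
  defines "S \<equiv> \<lambda>m. \<Sum>i=1..m. bs i * (-1) ^ (i - 1) * euclid_q a d (i - 1)"
  shows "1 - euclid_q a d m \<le> (-1) ^ m * S (Suc m) \<and> (-1) ^ m * S (Suc m) \<le> euclid_q a d (Suc m) - 1"
  using assms(3)
proof (induction m)
  case 0
  \<comment> \<open>Here $T_1 = b_1$, $q_0 = 1$ and $q_1 = k_1$, so the upper bound is exactly the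
    stricter condition on the first digit.\<close>
  then show ?case using assms(4,5) by (simp add: S_def euclid_q_def)
next
  case (Suc m)
  let ?q = "euclid_q a d" and ?x = "bs (Suc (Suc m))"
  have "0 \<le> ?q (Suc m)"
    using euclid_den_nonneg[OF assms(1,2)] Suc.prems by (simp add: euclid_q_def del: euclid_den.simps)
  moreover have "0 \<le> ?x" "?x \<le> euclid_k a d (Suc (Suc m))"
    using digits[of "Suc (Suc m)"] Suc.prems by auto
  ultimately have "0 \<le> ?x * ?q (Suc m)" "?x * ?q (Suc m) \<le> euclid_k a d (Suc (Suc m)) * ?q (Suc m)"
    by (auto intro: mult_right_mono)
  moreover have "(-1) ^ Suc m * S (Suc (Suc m)) = ?x * ?q (Suc m) - (-1) ^ m * S (Suc m)"
    by (simp add: S_def algebra_simps flip: power_add mult_2)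
  moreover have "?q (Suc (Suc m)) = ?q m + euclid_k a d (Suc (Suc m)) * ?q (Suc m)"
    by (simp add: euclid_q_def)
  \<comment> \<open>The sign change swaps the bounds: the old upper bound gives the new lower one,
    and the old lower bound gives the new upper one.\<close>
  ultimately show ?case using Suc by linarith
qed

theorem theorem2:
  fixes a d b c :: int and n :: nat and bs :: "nat \<Rightarrow> int"
  assumes "d \<ge> 2" and "0 < a" and "a < d" and "gcd a d = 1"
    and "n = euclid_length a d"
    and "0 \<le> b" and "b \<le> d - 1"
    and "b = (\<Sum>i=1..n+1. bs i * euclid_theta a d (i - 1))"
    and "bs (n + 1) = 0"
    and "0 \<le> bs 1" and "bs 1 \<le> euclid_k a d 1 - 1"
    and "\<And>i. 2 \<le> i \<Longrightarrow> i \<le> n \<Longrightarrow> 0 \<le> bs i \<and> bs i \<le> euclid_k a d i"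
    and "\<And>i. 1 \<le> i \<Longrightarrow> i + 1 \<le> n \<Longrightarrow> bs i = euclid_k a d i \<Longrightarrow> bs (i + 1) = 0"
    and "c = (\<Sum>i=1..n+1. bs i * (-1) ^ (i - 1) * euclid_q a d (i - 1))"
  shows "mod_quotient d a b \<in> {c, d + c}"
proof -
  have d: "0 < d" using assms(1) by simp
  have "euclid_theta a d n = 0"
    unfolding assms(5) euclid_length_def using euclid_theta_eventually_0[OF assms(2)] by (rule LeastI_ex)
  then have "n \<noteq> 0" using assms(2) euclid_theta_0[of a d] by (metis less_irrefl)
  then obtain m where n: "n = Suc m" using not0_implies_Suc by blast
  have "[a * c = b] (mod d)"
    unfolding assms(8,14) sum_distrib_left
  proof (rule cong_sum)
    fix i
    show "[a * (bs i * (-1) ^ (i - 1) * euclid_q a d (i - 1)) = bs i * euclid_theta a d (i - 1)] (mod d)"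
      using cong_scalar_left[OF cong_euclid_theta, of "bs i" a "i - 1" d] by (simp add: ac_simps)
  qed
  moreover have "[a * (d + c) = a * c] (mod d)"
    by (simp add: cong_iff_dvd_diff algebra_simps)
  ultimately have cong: "[a * c = b] (mod d)" "[a * (d + c) = b] (mod d)"
    using cong_trans by blast+
  \<comment> \<open>The vanishing last digit removes the term with $q_n$, leaving n = m + 1 terms,
    as the bounds require.\<close>
  have "c = (\<Sum>i=1..Suc m. bs i * (-1) ^ (i - 1) * euclid_q a d (i - 1))"
    using assms(9,14) n by simp
  then have "1 - euclid_q a d m \<le> (-1) ^ m * c \<and> (-1) ^ m * c \<le> euclid_q a d (Suc m) - 1"
    using alternating_digit_sum_bounds[of a d m bs] assms(2,5,10-12) d n by simp
  moreover have "euclid_q a d m \<le> d" "euclid_q a d (Suc m) \<le> d"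
    using euclid_den_le[OF assms(2) d, of m] euclid_den_le[OF assms(2) d, of "Suc m"] assms(5) n
    by (simp_all add: euclid_q_def del: euclid_den.simps)
  ultimately have "\<bar>(-1) ^ m * c\<bar> < d" by linarith
  then have "\<bar>c\<bar> < d" by (simp add: abs_mult power_abs)
  \<comment> \<open>The sign of c decides which candidate lies in [0, d); uniqueness then identifies
    it with the value chosen by \<open>THE\<close>.\<close>
  then have "\<exists>x\<in>{c, d + c}. 0 \<le> x \<and> x < d \<and> [a * x = b] (mod d)"
    using cong by (cases "0 \<le> c") auto
  moreover have "\<exists>!x. 0 \<le> x \<and> x < d \<and> [a * x = b] (mod d)"
    using mod_quotient_ex1[OF d] assms(4) by (simp add: coprime_iff_gcd_eq_1)
  ultimately show ?thesis
    unfolding mod_quotient_def by (metis (no_types, lifting) theI')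
qed

end
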